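(* If $\mathscr{C}$ is a positive variety, then $(\mathscr{C}\circ\mathsf{SU})\circ\mathsf{MOD}=[\mathscr{C}\circ\mathsf{SU}]$.
   Context: A class of languages $\mathscr{C}$ assigns to every alphabet $A$ a set $\mathscr{C}(A)$ of regular languages over $A$. A positive variety is a class in which each $\mathscr{C}(A)$ contains $\emptyset,A^*$, is closed under finite unions and intersections and under quotients $u^{-1}L=\{v\mid uv\in L\}$, $Lu^{-1}=\{v\mid vu\in L\}$, and which is closed under inverse images of all monoid morphisms $A^*\to B^*$. Enrichment: for a finite partition $\mathbf{P}$ of $A^*$, $[u]_{\mathbf{P}}$ is the block containing $u$; $\tau_{\mathbf{P}}:A^*\to(\mathbf{P}\times A)^*$ maps $a_1\cdots a_n$ to $b_1\cdots b_n$ with $b_i=([a_1\cdots a_{i-1}]_{\mathbf{P}},a_i)$, $\tau_{\mathbf{P}}(\varepsilon)=\varepsilon$. $(\mathscr{C}\circ\mathscr{D})(A)$ is the set of $L\subseteq A^*$ such that for some finite partition $\mathbf{P}$ of $A^*$ into languages of $\mathscr{D}(A)$ there are $L_P\in\mathscr{C}(\mathbf{P}\times A)$ with $L=\bigcup_{P\in\mathbf{P}}(\tau_{\mathbf{P}}^{-1}(L_P)\cap P)$. $\mathsf{MOD}(A)$: finite Boolean combinations of $\{w\mid |w|\equiv m\bmod d\}$ ($m<d$). $\mathsf{SU}(A)$: finite Boolean combinations of $A^*w$, $w\in A^*$. Block abstraction: for $d\ge1$, let $A_d$ be the finite alphabet whose letters are the nonempty words of $A^*$ of length at most $d$ (a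 word $w$ used as a letter is written $(w)$). Define $\mu_d:A^*\to A_d^*$: write $|w|=dq+r$ with $0\le r<d$ and $w=w_1\cdots w_{q+1}$ with $|w_i|=d$ for $i\le q$ and $|w_{q+1}|=r$; then $\mu_d(w)=(w_1)\cdots(w_q)$ if $r=0$ and $\mu_d(w)=(w_1)\cdots(w_q)(w_{q+1})$ otherwise. $[\mathscr{C}]_d(A)=\{\mu_d^{-1}(K)\mid K\in\mathscr{C}(A_d)\}$ and $[\mathscr{C}](A)=\bigcup_{d\ge1}[\mathscr{C}]_d(A)$. *)

theory Defs
  imports "HOL-Library.Disjoint_Sets" "HOL-Library.Infinite_Typeclass"
begin

text \<open>An alphabet is a finite set \<open>A\<close> of letters, possibly empty, and \<open>lists A\<close> is \<open>A\<^sup>*\<close>.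
  Since HOL cannot quantify over type-polymorphic families, a class of languages is given on the
  finite subsets of one infinite type \<open>'u\<close>, which contains a copy of every finite alphabet.
  Values at infinite sets are irrelevant.\<close>

type_synonym 'u lang_class = "'u set \<Rightarrow> 'u list set set"

text \<open>Recognition by a complete deterministic finite automaton.\<close>

definition regular_on :: "'a set \<Rightarrow> 'a list set \<Rightarrow> bool" where
  "regular_on A L \<longleftrightarrow>
     (\<exists>(Q :: nat set) \<delta> q0 F. finite Q \<and> q0 \<in> Q \<and> F \<subseteq> Q \<and> (\<forall>q\<in>Q. \<forall>a\<in>A. \<delta> q a \<in> Q) \<and>
        L = {w \<in> lists A. foldl \<delta> q0 w \<in> F})"

definition word_morphism :: "'a set \<Rightarrow> 'b set \<Rightarrow> ('a list \<Rightarrow> 'b list) \<Rightarrow> bool" where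
  "word_morphism A B \<alpha> \<longleftrightarrow>
     (\<forall>w\<in>lists A. \<alpha> w \<in> lists B) \<and> \<alpha> [] = [] \<and>
     (\<forall>u\<in>lists A. \<forall>v\<in>lists A. \<alpha> (u @ v) = \<alpha> u @ \<alpha> v)"

definition positive_variety :: "'u lang_class \<Rightarrow> bool" where
  "positive_variety C \<longleftrightarrow>
     (\<forall>A. finite A \<longrightarrow>
        (\<forall>L\<in>C A. regular_on A L) \<and>
        {} \<in> C A \<and> lists A \<in> C A \<and>
        (\<forall>K\<in>C A. \<forall>L\<in>C A. K \<union> L \<in> C A \<and> K \<inter> L \<in> C A) \<and>
        (\<forall>L\<in>C A. \<forall>u\<in>lists A.
           {v \<in> lists A. u @ v \<in> L} \<in> C A \<and> {v \<in> lists A. v @ u \<in> L} \<in> C A)) \<and>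
     (\<forall>A B \<alpha>. finite A \<longrightarrow> finite B \<longrightarrow> word_morphism A B \<alpha> \<longrightarrow>
        (\<forall>L\<in>C B. {w \<in> lists A. \<alpha> w \<in> L} \<in> C A))"

text \<open>The value of a class at a finite alphabet \<open>S\<close> whose letters are not elements of \<open>'u\<close>
  (e.g. pairs, or words): rename the letters injectively into \<open>'u\<close>. For classes closed
  under renaming of letters, the choice of \<open>e\<close> is immaterial; see \<open>class_at_iff\<close>.\<close>

definition class_at :: "'u lang_class \<Rightarrow> 'b set \<Rightarrow> 'b list set set" where
  "class_at C S = {K. K \<subseteq> lists S \<and> (\<exists>e. inj_on e S \<and> map e ` K \<in> C (e ` S))}"

definition block :: "'a list set set \<Rightarrow> 'a list \<Rightarrow> 'a list set" where
  "block PP u = (THE P. P \<in> PP \<and> u \<in> P)"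

definition enrich_word :: "'a list set set \<Rightarrow> 'a list \<Rightarrow> ('a list set \<times> 'a) list" where
  "enrich_word PP w = map (\<lambda>i. (block PP (take i w), w ! i)) [0..<length w]"

definition enrichment :: "'u lang_class \<Rightarrow> 'u lang_class \<Rightarrow> 'u lang_class" where
  "enrichment C D A =
     {L. \<exists>PP LL. partition_on (lists A) PP \<and> finite PP \<and> PP \<subseteq> D A \<and>
           (\<forall>P\<in>PP. LL P \<in> class_at C (PP \<times> A)) \<and>
           L = (\<Union>P\<in>PP. {w \<in> lists A. enrich_word PP w \<in> LL P} \<inter> P)}"

inductive_set boolean_combinations :: "'a set \<Rightarrow> 'a list set set \<Rightarrow> 'a list set set"
  for A :: "'a set" and G :: "'a list set set" where
  generator: "L \<in> G \<Longrightarrow> L \<in> boolean_combinations A G"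
| compl: "L \<in> boolean_combinations A G \<Longrightarrow> lists A - L \<in> boolean_combinations A G"
| union: "K \<in> boolean_combinations A G \<Longrightarrow> L \<in> boolean_combinations A G \<Longrightarrow>
    K \<union> L \<in> boolean_combinations A G"
| inter: "K \<in> boolean_combinations A G \<Longrightarrow> L \<in> boolean_combinations A G \<Longrightarrow>
    K \<inter> L \<in> boolean_combinations A G"

definition MOD :: "'u lang_class" where
  "MOD A = boolean_combinations A {{w \<in> lists A. length w mod d = m} | m d. m < d}"

definition SU :: "'u lang_class" where
  "SU A = boolean_combinations A {{v @ w | v. v \<in> lists A} | w. w \<in> lists A}"

definition block_alphabet :: "nat \<Rightarrow> 'a set \<Rightarrow> 'a list set" where
  "block_alphabet d A = {w \<in> lists A. w \<noteq> [] \<and> length w \<le> d}"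

definition block_word :: "nat \<Rightarrow> 'a list \<Rightarrow> 'a list list" where
  "block_word d w =
     (let q = length w div d; r = length w mod d in
        map (\<lambda>i. take d (drop (d * i) w)) [0..<q] @ (if r = 0 then [] else [drop (d * q) w]))"

definition block_abstraction_at :: "nat \<Rightarrow> 'u lang_class \<Rightarrow> 'u lang_class" where
  "block_abstraction_at d C A =
     {{w \<in> lists A. block_word d w \<in> K} | K. K \<in> class_at C (block_alphabet d A)}"

definition block_abstraction :: "'u lang_class \<Rightarrow> 'u lang_class" where
  "block_abstraction C A = (\<Union>d\<in>{1..}. block_abstraction_at d C A)"

lemma class_at_iff:
  assumes C: "positive_variety C" and S: "finite S" and e: "inj_on e S"
  shows "K \<in> class_at C S \<longleftrightarrow> K \<subseteq> lists S \<and> map e ` K \<in> C (e ` S)"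
proof
  assume "K \<in> class_at C S"
  then obtain f where K: "K \<subseteq> lists S" and f: "inj_on f S" and fK: "map f ` K \<in> C (f ` S)"
    unfolding class_at_def by blast
  define g where "g = f \<circ> inv_into S e"
  have ge: "map g (map e w) = map f w" if "w \<in> lists S" for w
    using that e by (simp add: g_def in_lists_conv_set)
  have "word_morphism (e ` S) (f ` S) (map g)"
    by (auto simp: word_morphism_def g_def in_lists_conv_set subset_iff inv_into_into)
  then have "{w \<in> lists (e ` S). map g w \<in> map f ` K} \<in> C (e ` S)"
    using C S fK unfolding positive_variety_def by (meson finite_imageI)
  moreover have "{w \<in> lists (e ` S). map g w \<in> map f ` K} = map e ` K"
  proof (intro set_eqI iffI)
    fix w assume "w \<in> {w \<in> lists (e ` S). map g w \<in> map f ` K}"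
    then obtain u v where u: "u \<in> lists S" "w = map e u" and v: "v \<in> K" "map g w = map f v"
      unfolding lists_image by blast
    have "map f u = map f v" using ge[OF u(1)] u(2) v(2) by (simp only:)
    then have "u = v"
      using inj_on_map_lists[OF f] u(1) v(1) K by (auto dest!: inj_onD)
    then show "w \<in> map e ` K" using u v by blast
  next
    fix w assume "w \<in> map e ` K"
    then obtain u where u: "u \<in> K" "w = map e u" by blast
    then have "u \<in> lists S" using K by blast
    then have "map g w \<in> map f ` K" using u ge by blast
    then show "w \<in> {w \<in> lists (e ` S). map g w \<in> map f ` K}"
      using u \<open>u \<in> lists S\<close> unfolding lists_image by blast
  qed
  ultimately show "K \<subseteq> lists S \<and> map e ` K \<in> C (e ` S)" using K by simp
next
  assume "K \<subseteq> lists S \<and> map e ` K \<in> C (e ` S)"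
  then show "K \<in> class_at C S"
    unfolding class_at_def mem_Collect_eq using e by (intro conjI exI[of _ e]) simp_all
qed

lemma class_at_self:
  assumes "positive_variety C" "finite A"
  shows "class_at C A = C A"
proof -
  have sub: "L \<subseteq> lists A" if "L \<in> C A" for L
  proof -
    have "regular_on A L"
      using assms that by (simp add: positive_variety_def)
    then show ?thesis by (auto simp: regular_on_def)
  qed
  have "K \<in> class_at C A \<longleftrightarrow> K \<subseteq> lists A \<and> K \<in> C A" for K
    by (simp add: class_at_iff[OF assms inj_on_id])
  then show ?thesis using sub by blast
qed

end

theory Submission
  imports Defs
begin

text \<open>
  A partition of \<open>A\<^sup>*\<close> into SU languages is refined by the labelling \<open>suff k\<close> for some \<open>k\<close>, and
  one into MOD languages by the length modulo some \<open>d\<close>. So both sides of the theorem reduce to: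
  feed the word, each letter decorated with finite information on the prefix before it, to a language
  of \<open>C\<close> that is chosen according to the same information on the whole word.

  From length modulo \<open>d\<close> to blocks: the decorations of the letters inside a block are determined by the
  block and the \<open>k + 1\<close> blocks before it, since every earlier block starts at a multiple of \<open>d\<close>. So
  the decorated word is a morphic image of the decorated block word.

  From blocks to length modulo \<open>d\<close>: the letters at positions congruent to \<open>d - 1\<close> see the whole block
  that they complete, so an erasing morphism outputs the decorated complete blocks at these positions. The
  last, incomplete block is determined by the last \<open>d\<close> letters and the length modulo \<open>d\<close>; a
  right quotient accounts for it.
\<close>

section \<open>Labellings of words\<close>

text \<open>Extends \<open>enrich_word\<close>, the case \<open>f = block PP\<close>, to labels of
  any type, so that suffixes and residues of lengths can decorate letters directly.\<close>

definition enrich :: "('a list \<Rightarrow> 'x) \<Rightarrow> 'a list \<Rightarrow> ('x \<times> 'a) list" where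
  "enrich f w = map (\<lambda>i. (f (take i w), w ! i)) [0..<length w]"

text \<open>Plays the part of \<open>enrichment\<close> for the partition of \<open>lists A\<close>
  into the fibres of \<open>f\<close>. The letters have their own type \<open>'a\<close>, since
  alphabets of pairs and of blocks occur.\<close>

definition label_enrichment ::
    "'u lang_class \<Rightarrow> ('a list \<Rightarrow> 'x) \<Rightarrow> 'a set \<Rightarrow> 'a list set set" where
  "label_enrichment C f A =
     {{w \<in> lists A. enrich f w \<in> LL (f w)} | LL.
        \<forall>x \<in> f ` lists A. LL x \<in> class_at C (f ` lists A \<times> A)}"

text \<open>In terms of partitions of \<open>lists A\<close>: the fibres of \<open>g\<close> refine
  those of \<open>f\<close>. A language \<open>P\<close> takes part as the labelling
  \<open>\<lambda>w. w \<in> P\<close>.\<close>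

definition determines :: "'a set \<Rightarrow> ('a list \<Rightarrow> 'x) \<Rightarrow> ('a list \<Rightarrow> 'y) \<Rightarrow> bool" where
  "determines A g f \<longleftrightarrow> (\<forall>u \<in> lists A. \<forall>v \<in> lists A. g u = g v \<longrightarrow> f u = f v)"

text \<open>Closure under inverse images of length-preserving morphisms. Isolated from
  \<open>positive_variety\<close> since \<open>enrichment C SU\<close>, the outer class in the
  enrichment by MOD, is shown to have it as well.\<close>

definition letter_closed :: "'u lang_class \<Rightarrow> bool" where
  "letter_closed C \<longleftrightarrow>
     (\<forall>A B \<phi>. finite A \<longrightarrow> finite B \<longrightarrow> \<phi> ` A \<subseteq> B \<longrightarrow>
        (\<forall>L \<in> C B. {w \<in> lists A. map \<phi> w \<in> L} \<in> C A))"

lemma determines_trans: "determines A h g \<Longrightarrow> determines A g f \<Longrightarrow> determines A h f"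
  unfolding determines_def by blast

lemma enrich_Nil [simp]: "enrich f [] = []"
  by (simp add: enrich_def)

lemma enrich_append: "enrich f (u @ v) = enrich f u @ enrich (\<lambda>t. f (u @ t)) v"
  by (rule nth_equalityI) (auto simp: enrich_def nth_append)

lemma enrich_single [simp]: "enrich f [a] = [(f [], a)]"
  by (simp add: enrich_def)

lemma enrich_snoc: "enrich f (u @ [a]) = enrich f u @ [(f u, a)]"
  by (simp add: enrich_append)

lemma length_enrich [simp]: "length (enrich f w) = length w"
  by (simp add: enrich_def)

lemma map_snd_enrich [simp]: "map snd (enrich f w) = w"
  by (rule nth_equalityI) (auto simp: enrich_def)

lemma enrich_cong:
  assumes "w \<in> lists A" "\<And>u. u \<in> lists A \<Longrightarrow> f u = g u"
  shows "enrich f w = enrich g w"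
  using assms(1) by (induction w rule: rev_induct) (auto simp: enrich_snoc assms(2))

lemma enrich_in_lists:
  assumes "w \<in> lists A" "\<And>u. u \<in> lists A \<Longrightarrow> f u \<in> X"
  shows "enrich f w \<in> lists (X \<times> A)"
  using assms(1) by (induction w rule: rev_induct) (auto simp: enrich_snoc assms(2))

lemma enrich_in_lists_image: "w \<in> lists A \<Longrightarrow> enrich f w \<in> lists (f ` lists A \<times> A)"
  by (rule enrich_in_lists) auto

lemma map_enrich: "map (\<lambda>(x, a). (h x, a)) (enrich f w) = enrich (\<lambda>u. h (f u)) w"
  by (simp add: enrich_def)


section \<open>Closure properties transported to arbitrary letter types\<close>

text \<open>Provides, for any finite alphabet, the renaming that membership in
  \<open>class_at\<close> asks for.\<close>

lemma finite_inj_into_infinite: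
  assumes "finite S"
  obtains e :: "'b \<Rightarrow> 'u::infinite" where "inj_on e S"
proof -
  obtain T :: "'u set" where T: "finite T" "card T = card S"
    using infinite_arbitrarily_large[OF infinite_UNIV] by metis
  then obtain e where "bij_betw e S T"
    using finite_same_card_bij[OF assms T(1)] by auto
  then show thesis using that bij_betw_imp_inj_on by blast
qed

lemma map_inv_into_map:
  assumes "inj_on e S" "w \<in> lists S"
  shows "map (inv_into S e) (map e w) = w"
  using assms by (simp add: map_idI in_lists_conv_set)

text \<open>Rename \<open>S\<close> by any \<open>e\<close> and \<open>T\<close> by the
  \<open>f\<close> that witnesses \<open>K\<close>. Conjugated by these, \<alpha> becomes a map
  between words over \<open>'u\<close>, to which \<open>closed\<close> applies. Leaving \<alpha>
  arbitrary covers letter maps and morphisms at once.\<close>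

lemma class_at_preimage:
  fixes C :: "'u::infinite lang_class" and \<alpha> :: "'b list \<Rightarrow> 'c list"
  assumes S: "finite S" and K: "K \<in> class_at C T"
    and \<alpha>: "\<And>w. w \<in> lists S \<Longrightarrow> \<alpha> w \<in> lists T"
    and closed: "\<And>e f L. inj_on e S \<Longrightarrow> inj_on f T \<Longrightarrow> L \<in> C (f ` T) \<Longrightarrow>
      {w \<in> lists (e ` S). map f (\<alpha> (map (inv_into S e) w)) \<in> L} \<in> C (e ` S)"
  shows "{w \<in> lists S. \<alpha> w \<in> K} \<in> class_at C S"
proof -
  obtain f where KT: "K \<subseteq> lists T" and f: "inj_on f T" and fK: "map f ` K \<in> C (f ` T)"
    using K unfolding class_at_def by blast
  obtain e :: "'b \<Rightarrow> 'u" where e: "inj_on e S" using finite_inj_into_infinite[OF S] by blast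
  have iff: "map f (\<alpha> w) \<in> map f ` K \<longleftrightarrow> \<alpha> w \<in> K" if "w \<in> lists S" for w
  proof
    assume "map f (\<alpha> w) \<in> map f ` K"
    then obtain y where "y \<in> K" "map f (\<alpha> w) = map f y" by blast
    moreover have "inj_on (map f) (lists T)" by (rule inj_on_map_lists[OF f])
    ultimately have "\<alpha> w = y" using \<alpha>[OF that] KT by (auto dest: inj_onD)
    then show "\<alpha> w \<in> K" using \<open>y \<in> K\<close> by simp
  qed blast
  have "{w \<in> lists (e ` S). map f (\<alpha> (map (inv_into S e) w)) \<in> map f ` K} \<in> C (e ` S)"
    by (rule closed[OF e f fK])
  also have "{w \<in> lists (e ` S). map f (\<alpha> (map (inv_into S e) w)) \<in> map f ` K}
      = {w \<in> map e ` lists S. map f (\<alpha> (map (inv_into S e) w)) \<in> map f ` K}"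
    unfolding lists_image ..
  also have "\<dots> = map e ` {w \<in> lists S. map f (\<alpha> (map (inv_into S e) (map e w))) \<in> map f ` K}"
    by blast
  also have "{w \<in> lists S. map f (\<alpha> (map (inv_into S e) (map e w))) \<in> map f ` K}
      = {w \<in> lists S. \<alpha> w \<in> K}"
    by (rule Collect_cong) (metis iff map_inv_into_map[OF e])
  finally have "map e ` {w \<in> lists S. \<alpha> w \<in> K} \<in> C (e ` S)" .
  then show ?thesis unfolding class_at_def mem_Collect_eq
    using e by (intro conjI exI[of _ e]) auto
qed

lemma class_at_map_preimage:
  fixes C :: "'u::infinite lang_class" and S :: "'b set" and T :: "'c set"
  assumes C: "letter_closed C" and "finite S" "finite T" "\<phi> ` S \<subseteq> T" "K \<in> class_at C T"
  shows "{w \<in> lists S. map \<phi> w \<in> K} \<in> class_at C S"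
proof (rule class_at_preimage[OF \<open>finite S\<close> \<open>K \<in> class_at C T\<close>])
  fix e :: "'b \<Rightarrow> 'u" and f :: "'c \<Rightarrow> 'u" and L
  assume "inj_on e S" "L \<in> C (f ` T)"
  moreover from this have "(f \<circ> \<phi> \<circ> inv_into S e) ` (e ` S) \<subseteq> f ` T" using assms(4) by auto
  ultimately have "{w \<in> lists (e ` S). map (f \<circ> \<phi> \<circ> inv_into S e) w \<in> L} \<in> C (e ` S)"
    using C assms(2,3) unfolding letter_closed_def by (meson finite_imageI)
  then show "{w \<in> lists (e ` S). map f (map \<phi> (map (inv_into S e) w)) \<in> L} \<in> C (e ` S)"
    by (simp add: comp_assoc)
qed (use assms(4) in \<open>auto simp: in_lists_conv_set\<close>)

lemma class_at_morphism_preimage: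
  fixes C :: "'u::infinite lang_class" and S :: "'b set" and T :: "'c set"
  assumes C: "positive_variety C" and "finite S" "finite T" and \<alpha>: "word_morphism S T \<alpha>"
    and K: "K \<in> class_at C T"
  shows "{w \<in> lists S. \<alpha> w \<in> K} \<in> class_at C S"
proof (rule class_at_preimage[OF \<open>finite S\<close> K])
  fix e :: "'b \<Rightarrow> 'u" and f :: "'c \<Rightarrow> 'u" and L
  assume e: "inj_on e S" and L: "L \<in> C (f ` T)"
  have inv: "map (inv_into S e) w \<in> lists S" if "w \<in> lists (e ` S)" for w
    using that by (auto simp: in_lists_conv_set inv_into_into)
  have "word_morphism (e ` S) (f ` T) (\<lambda>w. map f (\<alpha> (map (inv_into S e) w)))"
    using \<alpha> inv unfolding word_morphism_def lists_image[of f] by simp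
  then show "{w \<in> lists (e ` S). map f (\<alpha> (map (inv_into S e) w)) \<in> L} \<in> C (e ` S)"
    using C assms(2,3) L unfolding positive_variety_def by (meson finite_imageI)
qed (use \<alpha> in \<open>simp add: word_morphism_def\<close>)

lemma class_at_empty:
  fixes C :: "'u::infinite lang_class" and S :: "'b set"
  assumes "positive_variety C" "finite S"
  shows "{} \<in> class_at C S"
proof -
  obtain e :: "'b \<Rightarrow> 'u" where "inj_on e S" using finite_inj_into_infinite[OF assms(2)] by blast
  then show ?thesis using assms by (auto simp: class_at_def positive_variety_def)
qed

lemma class_at_right_quotient:
  fixes C :: "'u::infinite lang_class"
  assumes C: "positive_variety C" and S: "finite S" and K: "K \<in> class_at C S"
  shows "{v \<in> lists S. v @ u \<in> K} \<in> class_at C S"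
proof (cases "u \<in> lists S")
  \<comment> \<open>A letter of \<open>u\<close> outside \<open>S\<close> makes the quotient empty,
    so \<open>u\<close> may be any word.\<close>
  case False
  then have "{v \<in> lists S. v @ u \<in> K} = {}" using K by (auto simp: class_at_def)
  then show ?thesis using class_at_empty[OF C S] by (simp only:)
next
  case True
  obtain e where KS: "K \<subseteq> lists S" and e: "inj_on e S" and eK: "map e ` K \<in> C (e ` S)"
    using K unfolding class_at_def by blast
  have iff: "map e v @ map e u \<in> map e ` K \<longleftrightarrow> v @ u \<in> K" if "v \<in> lists S" for v
  proof
    assume "map e v @ map e u \<in> map e ` K"
    then obtain y where "y \<in> K" "map e (v @ u) = map e y" by auto
    moreover have "inj_on (map e) (lists S)" by (rule inj_on_map_lists[OF e])
    ultimately have "v @ u = y" using that True KS by (auto simp del: map_append dest!: inj_onD)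
    then show "v @ u \<in> K" using \<open>y \<in> K\<close> by simp
  next
    assume "v @ u \<in> K"
    then have "map e (v @ u) \<in> map e ` K" by blast
    then show "map e v @ map e u \<in> map e ` K" by simp
  qed
  have "map e u \<in> lists (e ` S)" using True by (auto simp: lists_image)
  then have "{v \<in> lists (e ` S). v @ map e u \<in> map e ` K} \<in> C (e ` S)"
    using C eK S unfolding positive_variety_def by (meson finite_imageI)
  also have "{v \<in> lists (e ` S). v @ map e u \<in> map e ` K}
      = map e ` {v \<in> lists S. map e v @ map e u \<in> map e ` K}"
    unfolding lists_image by blast
  also have "{v \<in> lists S. map e v @ map e u \<in> map e ` K} = {v \<in> lists S. v @ u \<in> K}"
    using iff by blast
  finally show ?thesis unfolding class_at_def mem_Collect_eq
    using e by (intro conjI exI[of _ e]) auto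
qed

lemma positive_variety_letter_closed:
  assumes "positive_variety C"
  shows "letter_closed C"
  unfolding letter_closed_def
proof (intro allI impI ballI)
  fix A B L and \<phi> :: "'a \<Rightarrow> 'a"
  assume *: "finite A" "finite B" "\<phi> ` A \<subseteq> B" "L \<in> C B"
  then have "word_morphism A B (map \<phi>)" by (auto simp: word_morphism_def in_lists_conv_set)
  then show "{w \<in> lists A. map \<phi> w \<in> L} \<in> C A"
    using assms * unfolding positive_variety_def by meson
qed


section \<open>Enrichment by a labelling\<close>

lemma label_enrichmentE:
  assumes "L \<in> label_enrichment C f A"
  obtains LL where "\<And>x. x \<in> f ` lists A \<Longrightarrow> LL x \<in> class_at C (f ` lists A \<times> A)"
    "L = {w \<in> lists A. enrich f w \<in> LL (f w)}"
  using assms unfolding label_enrichment_def by blast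

text \<open>Since \<open>g\<close> determines \<open>f\<close>, there is \<open>h\<close> with
  \<open>f u = h (g u)\<close> on \<open>lists A\<close>. The letter map sending
  \<open>(y, a)\<close> to \<open>(h y, a)\<close> turns the finer decoration into the coarser one,
  and inverse images under letter maps stay in the class.\<close>

lemma label_enrichment_determines:
  fixes C :: "'u::infinite lang_class"
  assumes C: "letter_closed C" and A: "finite A"
    and g: "finite (g ` lists A)" and gf: "determines A g f"
  shows "label_enrichment C f A \<subseteq> label_enrichment C g A"
proof
  fix L assume "L \<in> label_enrichment C f A"
  then obtain LL where LL: "\<And>x. x \<in> f ` lists A \<Longrightarrow> LL x \<in> class_at C (f ` lists A \<times> A)"
    and L: "L = {w \<in> lists A. enrich f w \<in> LL (f w)}"
    unfolding label_enrichment_def by blast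
  \<comment> \<open>For a label \<open>y\<close> of \<open>g\<close>, all words of
    \<open>lists A\<close> with that label have the same \<open>f\<close>, so any chosen one will
    do.\<close>
  define h where "h y = f (SOME u. u \<in> lists A \<and> g u = y)" for y
  have h: "h (g u) = f u" if "u \<in> lists A" for u
    using someI[of "\<lambda>v. v \<in> lists A \<and> g v = g u" u] that gf unfolding h_def determines_def by blast
  let ?\<phi> = "\<lambda>(y, a). (h y, a)"
  have eq: "map ?\<phi> (enrich g w) = enrich f w" if "w \<in> lists A" for w
    using enrich_cong[OF that, of "\<lambda>u. h (g u)" f] h by (simp add: map_enrich)
  have f_fin: "finite (f ` lists A)"
    using finite_imageI[OF g, of h] by (simp add: image_image h cong: image_cong_simp)
  define MM where "MM y = {v \<in> lists (g ` lists A \<times> A). map ?\<phi> v \<in> LL (h y)}" for y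
  have "MM y \<in> class_at C (g ` lists A \<times> A)" if "y \<in> g ` lists A" for y
    unfolding MM_def using that
    by (intro class_at_map_preimage[OF C, where T = "f ` lists A \<times> A"])
       (use A g f_fin LL h in \<open>auto simp del: in_lists_conv_set\<close>)
  moreover have "L = {w \<in> lists A. enrich g w \<in> MM (g w)}"
    using eq h enrich_in_lists_image[of _ A g]
    by (simp add: L MM_def del: in_lists_conv_set cong: conj_cong)
  ultimately show "L \<in> label_enrichment C g A" unfolding label_enrichment_def by blast
qed

text \<open>This is how both inclusions build their languages on the target side. The decorated word
  may pass through any morphism, possibly erasing, and a word depending on the final label may be
  appended. The former is an inverse image, the latter a right quotient, by a fixed word once the
  label is fixed.\<close>

lemma label_enrichmentI:
  fixes C :: "'u::infinite lang_class"
  assumes C: "positive_variety C" and A: "finite A" and f: "finite (f ` lists A)"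
    and T: "finite T" and \<alpha>: "\<And>x a. x \<in> f ` lists A \<Longrightarrow> a \<in> A \<Longrightarrow> \<alpha> (x, a) \<in> lists T"
    and KK: "\<And>x. x \<in> f ` lists A \<Longrightarrow> KK x \<in> class_at C T"
  shows "{w \<in> lists A. concat (map \<alpha> (enrich f w)) @ c (f w) \<in> KK (f w)} \<in> label_enrichment C f A"
proof -
  let ?S = "f ` lists A \<times> A"
  have mor: "word_morphism ?S T (\<lambda>w. concat (map \<alpha> w))"
    using \<alpha> by (fastforce simp: word_morphism_def in_lists_conv_set)
  define LL where "LL x = {v \<in> lists ?S. concat (map \<alpha> v) \<in> {v \<in> lists T. v @ c x \<in> KK x}}" for x
  have "LL x \<in> class_at C ?S" if "x \<in> f ` lists A" for x
    unfolding LL_def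
    using A f T that by (intro class_at_morphism_preimage[OF C _ T mor]
        class_at_right_quotient[OF C T] KK) auto
  moreover have "{w \<in> lists A. concat (map \<alpha> (enrich f w)) @ c (f w) \<in> KK (f w)}
      = {w \<in> lists A. enrich f w \<in> LL (f w)}"
  proof (intro Collect_cong conj_cong refl)
    fix w assume "w \<in> lists A"
    then have "enrich f w \<in> lists ?S" by (rule enrich_in_lists_image)
    moreover from this have "concat (map \<alpha> (enrich f w)) \<in> lists T"
      using mor by (simp add: word_morphism_def)
    ultimately show "concat (map \<alpha> (enrich f w)) @ c (f w) \<in> KK (f w) \<longleftrightarrow> enrich f w \<in> LL (f w)"
      by (simp add: LL_def)
  qed
  ultimately show ?thesis unfolding label_enrichment_def by blast
qed

lemma partition_block:
  assumes "partition_on S PP" "P \<in> PP" "w \<in> P"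
  shows "block PP w = P"
  unfolding block_def using assms
  by (intro the_equality) (auto simp: partition_on_def disjoint_def)

lemma enrichment_iff_block:
  "L \<in> enrichment C D A \<longleftrightarrow>
     (\<exists>PP. partition_on (lists A) PP \<and> finite PP \<and> PP \<subseteq> D A \<and> L \<in> label_enrichment C (block PP) A)"
proof -
  have "(\<exists>LL. (\<forall>P\<in>PP. LL P \<in> class_at C (PP \<times> A)) \<and>
           L = (\<Union>P\<in>PP. {w \<in> lists A. enrich_word PP w \<in> LL P} \<inter> P))
        \<longleftrightarrow> L \<in> label_enrichment C (block PP) A" if PP: "partition_on (lists A) PP" for PP
  proof -
    have un: "\<Union>PP = lists A" and ne: "{} \<notin> PP" using PP by (auto simp: partition_on_def)
    \<comment> \<open>No block is empty, so every block is the label of some word, and both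
      enrichments use the same alphabet \<open>PP \<times> A\<close>.\<close>
    have im: "block PP ` lists A = PP"
    proof (intro set_eqI iffI)
      fix P assume P: "P \<in> PP"
      then obtain w where "w \<in> P" using ne by (metis equals0I)
      then show "P \<in> block PP ` lists A" using partition_block[OF PP P] un P by blast
    next
      fix P assume "P \<in> block PP ` lists A"
      then obtain w where "w \<in> lists A" "P = block PP w" by blast
      then show "P \<in> PP" using partition_block[OF PP] un by (metis UnionE)
    qed
    have "(\<Union>P\<in>PP. {w \<in> lists A. enrich_word PP w \<in> LL P} \<inter> P)
        = {w \<in> lists A. enrich (block PP) w \<in> LL (block PP w)}" for LL
    proof -
      have "enrich_word PP = enrich (block PP)" by (simp add: fun_eq_iff enrich_word_def enrich_def)
      moreover have "w \<in> block PP w" "block PP w \<in> PP" if "w \<in> lists A" for w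
        using that un partition_block[OF PP] by blast+
      moreover have "P = block PP w" if "P \<in> PP" "w \<in> P" for P w
        using that partition_block[OF PP] by blast
      ultimately show ?thesis by (intro set_eqI iffI) (simp; blast)+
    qed
    then show ?thesis unfolding label_enrichment_def im by auto
  qed
  then show ?thesis unfolding enrichment_def by blast
qed

section \<open>Directed families of labellings\<close>

locale label_family =
  fixes A :: "'a::infinite set" and I :: "'i set" and f :: "'i \<Rightarrow> 'a list \<Rightarrow> 'x"
  assumes directed: "i \<in> I \<Longrightarrow> j \<in> I \<Longrightarrow>
      \<exists>k \<in> I. determines A (f k) (f i) \<and> determines A (f k) (f j)"
    and index_nonempty: "I \<noteq> {}"
    and finite_labels: "i \<in> I \<Longrightarrow> finite (f i ` lists A)"
begin

lemma finite_directed: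
  assumes "finite J" "J \<subseteq> I"
  shows "\<exists>k \<in> I. \<forall>j \<in> J. determines A (f k) (f j)"
  using assms
proof (induction J)
  case empty then show ?case using index_nonempty by blast
next
  case (insert j J)
  then show ?case using directed by (metis determines_trans insert_iff insert_subset)
qed

text \<open>The languages determined by some labelling of the family form a Boolean algebra: a union
  or an intersection is determined by a common refinement of two labellings, which
  \<open>directed\<close> supplies.\<close>

lemma boolean_combinations_determined:
  assumes "\<And>P. P \<in> G \<Longrightarrow> \<exists>i \<in> I. determines A (f i) (\<lambda>w. w \<in> P)"
    and "P \<in> boolean_combinations A G"
  shows "\<exists>i \<in> I. determines A (f i) (\<lambda>w. w \<in> P)"
  using assms(2)
proof (induction)
  case (generator L) then show ?case by (rule assms(1))
next
  case (compl L) then show ?case unfolding determines_def by (metis Diff_iff)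
next
  case (union K L)
  then obtain i j where ij: "i \<in> I" "determines A (f i) (\<lambda>w. w \<in> K)"
    "j \<in> I" "determines A (f j) (\<lambda>w. w \<in> L)" by blast
  then obtain k where "k \<in> I" "determines A (f k) (f i)" "determines A (f k) (f j)"
    using directed by blast
  with ij have "k \<in> I" "determines A (f k) (\<lambda>w. w \<in> K)" "determines A (f k) (\<lambda>w. w \<in> L)"
    by (blast intro: determines_trans)+
  then show ?case unfolding determines_def by (metis Un_iff)
next
  case (inter K L)
  then obtain i j where ij: "i \<in> I" "determines A (f i) (\<lambda>w. w \<in> K)"
    "j \<in> I" "determines A (f j) (\<lambda>w. w \<in> L)" by blast
  then obtain k where "k \<in> I" "determines A (f k) (f i)" "determines A (f k) (f j)"
    using directed by blast
  with ij have "k \<in> I" "determines A (f k) (\<lambda>w. w \<in> K)" "determines A (f k) (\<lambda>w. w \<in> L)"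
    by (blast intro: determines_trans)+
  then show ?case unfolding determines_def by (metis Int_iff)
qed

text \<open>A partition has finitely many blocks, each determined by some \<open>f i\<close>, so a
  common refinement determines \<open>block PP\<close>. Conversely, the fibres of one
  \<open>f i\<close> form a finite partition into languages of \<open>D A\<close>, whose blocks
  carry the same information as the labels.\<close>

lemma enrichment_eq:
  fixes C :: "'a lang_class"
  assumes C: "letter_closed C" and A: "finite A" and D: "D A = boolean_combinations A G"
    and G: "\<And>P. P \<in> G \<Longrightarrow> \<exists>i \<in> I. determines A (f i) (\<lambda>w. w \<in> P)"
    and fibres: "\<And>i u. i \<in> I \<Longrightarrow> u \<in> lists A \<Longrightarrow> {w \<in> lists A. f i w = f i u} \<in> D A"
  shows "enrichment C D A = (\<Union>i \<in> I. label_enrichment C (f i) A)"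
proof (intro equalityI subsetI)
  fix L assume "L \<in> enrichment C D A"
  then obtain PP where PP: "partition_on (lists A) PP" "finite PP" "PP \<subseteq> D A"
    and L: "L \<in> label_enrichment C (block PP) A"
    unfolding enrichment_iff_block by blast
  have "\<forall>P \<in> PP. \<exists>i \<in> I. determines A (f i) (\<lambda>w. w \<in> P)"
    using PP(3) boolean_combinations_determined[OF G] unfolding D by blast
  then obtain j where j: "\<forall>P \<in> PP. j P \<in> I \<and> determines A (f (j P)) (\<lambda>w. w \<in> P)"
    by metis
  then obtain i where i: "i \<in> I" "\<forall>P \<in> PP. determines A (f i) (f (j P))"
    using finite_directed[of "j ` PP"] PP(2) by auto
  have "determines A (f i) (block PP)"
    unfolding determines_def
  proof (intro ballI impI)
    fix u v assume u: "u \<in> lists A" and v: "v \<in> lists A" and uv: "f i u = f i v"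
    obtain P where P: "P \<in> PP" "u \<in> P" using PP(1) u unfolding partition_on_def by blast
    moreover have "determines A (f i) (\<lambda>w. w \<in> P)" using i j P(1) determines_trans by blast
    ultimately have "v \<in> P" using u v uv unfolding determines_def by blast
    then show "block PP u = block PP v" using P partition_block[OF PP(1) P(1)] by simp
  qed
  then have "L \<in> label_enrichment C (f i) A"
    using L label_enrichment_determines[OF C A finite_labels[OF i(1)]] by blast
  then show "L \<in> (\<Union>i \<in> I. label_enrichment C (f i) A)" using i(1) by blast
next
  fix L assume "L \<in> (\<Union>i \<in> I. label_enrichment C (f i) A)"
  then obtain i where i: "i \<in> I" and L: "L \<in> label_enrichment C (f i) A" by blast
  define PP where "PP = (\<lambda>x. {w \<in> lists A. f i w = x}) ` f i ` lists A"
  have part: "partition_on (lists A) PP"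
    unfolding PP_def by (intro partition_onI) (auto simp: disjnt_def)
  have fin: "finite PP" unfolding PP_def using finite_labels[OF i] by (rule finite_imageI)
  have "block PP u = {w \<in> lists A. f i w = f i u}" if "u \<in> lists A" for u
    by (rule partition_block[OF part]) (use that in \<open>auto simp: PP_def\<close>)
  then have "determines A (block PP) (f i)" unfolding determines_def by blast
  moreover have "block PP ` lists A \<subseteq> PP"
    using \<open>\<And>u. u \<in> lists A \<Longrightarrow> block PP u = _ u\<close> by (auto simp: PP_def)
  then have "finite (block PP ` lists A)" using fin by (rule finite_subset)
  ultimately have "L \<in> label_enrichment C (block PP) A"
    using L label_enrichment_determines[OF C A] by blast
  moreover have "PP \<subseteq> D A" using fibres[OF i] by (auto simp: PP_def simp del: in_lists_conv_set)
  ultimately show "L \<in> enrichment C D A" unfolding enrichment_iff_block using part fin by blast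
qed

end


section \<open>The labellings of SU and MOD\<close>

definition suff :: "nat \<Rightarrow> 'a list \<Rightarrow> 'a list" where
  "suff k w = drop (length w - k) w"

lemma suff_append: "suff k (u @ v) = (if k \<le> length v then suff k v else suff (k - length v) u @ v)"
  by (simp add: suff_def)

lemma suff_suff: "j \<le> k \<Longrightarrow> suff j (suff k w) = suff j w"
  by (cases "k \<le> length w") (auto simp: suff_def)

lemma suff_id: "length w \<le> k \<Longrightarrow> suff k w = w"
  by (simp add: suff_def)

lemma suff_0 [simp]: "suff 0 w = []"
  by (simp add: suff_def)

lemma length_suff [simp]: "length (suff k w) = min (length w) k"
  by (auto simp: suff_def)

lemma suff_in_lists: "w \<in> lists A \<Longrightarrow> suff k w \<in> lists A"
  by (auto simp: suff_def in_lists_conv_set dest: in_set_dropD)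

lemma suff_image_lists: "suff k ` lists A \<subseteq> lists A"
  by (rule image_subsetI) (rule suff_in_lists)

lemma suff_map: "suff k (map \<phi> w) = map \<phi> (suff k w)"
  by (simp add: suff_def drop_map)

lemma suff_suff_append: "suff k (suff k u @ v) = suff k (u @ v)"
  by (auto simp: suff_append suff_suff)

lemma append_suff: "take (length w - k) w @ suff k w = w"
  by (simp add: suff_def)

lemma suff_eq_iff: "length x = k \<Longrightarrow> suff k w = x \<longleftrightarrow> (\<exists>v. w = v @ x)"
  by (metis append_suff order_refl suff_append suff_id)

lemma finite_suff_image:
  assumes "finite A"
  shows "finite (suff k ` lists A)"
proof (rule finite_subset)
  show "suff k ` lists A \<subseteq> {w. set w \<subseteq> A \<and> length w \<le> k}"
    using suff_in_lists[of _ A k] by (auto simp: in_lists_conv_set)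
qed (rule finite_lists_length_le[OF assms])

lemma suff_determines: "j \<le> k \<Longrightarrow> determines A (suff k) (suff j)"
  unfolding determines_def by (metis suff_suff)

lemma label_family_suff:
  assumes "finite A"
  shows "label_family A UNIV suff"
proof
  fix i j :: nat
  show "\<exists>k\<in>UNIV. determines A (suff k) (suff i) \<and> determines A (suff k) (suff j)"
    using suff_determines[of i "max i j" A] suff_determines[of j "max i j" A] by auto
qed (use assms in \<open>simp_all add: finite_suff_image\<close>)

lemma suffix_language_in_SU: "x \<in> lists A \<Longrightarrow> {w \<in> lists A. \<exists>v. w = v @ x} \<in> SU A"
proof -
  assume "x \<in> lists A"
  then have "{w \<in> lists A. \<exists>v. w = v @ x} \<in> {{v @ w | v. v \<in> lists A} | w. w \<in> lists A}"
    by (fastforce simp del: in_lists_conv_set)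
  then show ?thesis unfolding SU_def by (rule boolean_combinations.generator)
qed

lemma SU_empty: "{} \<in> SU A"
proof -
  have "lists A \<in> SU A" using suffix_language_in_SU[of "[]" A] by simp
  then have "lists A - lists A \<in> SU A" unfolding SU_def by (rule boolean_combinations.compl)
  then show ?thesis by simp
qed

lemma SU_finite_Union: "finite J \<Longrightarrow> (\<And>j. j \<in> J \<Longrightarrow> X j \<in> SU A) \<Longrightarrow> (\<Union>j\<in>J. X j) \<in> SU A"
proof (induction J rule: finite_induct)
  case empty then show ?case using SU_empty by simp
next
  case (insert j J)
  then have "X j \<union> (\<Union>j\<in>J. X j) \<in> SU A"
    by (auto simp: SU_def intro!: boolean_combinations.union)
  then show ?case by simp
qed

text \<open>A suffix of full length \<open>k\<close> gives a generator of SU. A shorter one is the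
  entire word, and the singleton \<open>{x}\<close> consists of the words that end in
  \<open>x\<close> but in no \<open>a # x\<close>.\<close>

lemma suff_fibre_in_SU:
  assumes A: "finite A" and u: "u \<in> lists A"
  shows "{w \<in> lists A. suff k w = suff k u} \<in> SU A"
proof -
  define x where "x = suff k u"
  have x: "x \<in> lists A" unfolding x_def by (rule suff_in_lists[OF u])
  show ?thesis
  proof (cases "length x = k")
    case True
    then have "{w \<in> lists A. suff k w = x} = {w \<in> lists A. \<exists>v. w = v @ x}"
      by (simp add: suff_eq_iff)
    then show ?thesis using suffix_language_in_SU[OF x] unfolding x_def by simp
  next
    case False
    then have short: "length x < k" by (simp add: x_def)
    let ?U = "\<lambda>y. {w \<in> lists A. \<exists>v. w = v @ y}"
    have suff_x: "suff k w = x \<longleftrightarrow> w = x" for w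
    proof
      assume "suff k w = x"
      moreover from this have "length w \<le> k" using short by auto
      ultimately show "w = x" by (simp add: suff_id)
    qed (use short in \<open>simp add: suff_id\<close>)
    have "{w \<in> lists A. suff k w = x} = ?U x \<inter> (lists A - (\<Union>a\<in>A. ?U (a # x)))"
    proof (intro equalityI subsetI)
      fix w assume "w \<in> {w \<in> lists A. suff k w = x}"
      then show "w \<in> ?U x \<inter> (lists A - (\<Union>a\<in>A. ?U (a # x)))"
        using x by (auto simp: suff_x)
    next
      fix w assume w: "w \<in> ?U x \<inter> (lists A - (\<Union>a\<in>A. ?U (a # x)))"
      then obtain v where v: "w = v @ x" by blast
      then have "v = []" using w by (cases v rule: rev_cases) auto
      then show "w \<in> {w \<in> lists A. suff k w = x}" using v x by (simp add: suff_x)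
    qed
    moreover have "(\<Union>a\<in>A. ?U (a # x)) \<in> SU A"
      using x by (intro SU_finite_Union[OF A] suffix_language_in_SU) auto
    ultimately have "{w \<in> lists A. suff k w = x} \<in> SU A"
      using suffix_language_in_SU[OF x] unfolding SU_def
      by (auto intro: boolean_combinations.intros)
    then show ?thesis by (simp add: x_def)
  qed
qed

lemma enrichment_SU:
  fixes C :: "'u::infinite lang_class"
  assumes "letter_closed C" "finite A"
  shows "enrichment C SU A = (\<Union>k. label_enrichment C (suff k) A)"
proof -
  interpret label_family A UNIV suff using assms(2) by (rule label_family_suff)
  show ?thesis
  proof (rule enrichment_eq[OF assms, of SU, OF SU_def])
    fix P assume "P \<in> {{v @ w |v. v \<in> lists A} |w. w \<in> lists A}"
    then obtain x where x: "P = {v @ x | v. v \<in> lists A}" by blast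
    have "w \<in> P \<longleftrightarrow> suff (length x) w = x" if "w \<in> lists A" for w
      using that by (auto simp: x suff_eq_iff)
    then have "determines A (suff (length x)) (\<lambda>w. w \<in> P)" by (simp add: determines_def)
    then show "\<exists>i\<in>UNIV. determines A (suff i) (\<lambda>w. w \<in> P)" by blast
  qed (rule suff_fibre_in_SU[OF assms(2)])
qed

lemma enrichment_MOD:
  fixes C :: "'u::infinite lang_class"
  assumes "letter_closed C" "finite A"
  shows "enrichment C MOD A = (\<Union>d\<in>{1..}. label_enrichment C (\<lambda>w. length w mod d) A)"
proof -
  have det: "determines A (\<lambda>w. length w mod d) (\<lambda>w. length w mod e)" if "e dvd d" for d e :: nat
    unfolding determines_def by (metis mod_mod_cancel that)
  interpret label_family A "{1..}" "\<lambda>d w. length w mod d"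
  proof
    fix i j :: nat assume "i \<in> {1..}" "j \<in> {1..}"
    \<comment> \<open>The residue modulo \<open>i * j\<close> determines those modulo
      \<open>i\<close> and \<open>j\<close>, so it gives a common refinement.\<close>
    then have "i * j \<in> {1..}" by simp
    then show "\<exists>k\<in>{1..}. determines A (\<lambda>w. length w mod k) (\<lambda>w. length w mod i) \<and>
                   determines A (\<lambda>w. length w mod k) (\<lambda>w. length w mod j)"
      using det[of i "i * j"] det[of j "i * j"] by auto
  next
    fix i :: nat assume "i \<in> {1..}"
    then have "(\<lambda>w. length w mod i) ` lists A \<subseteq> {..<i}" by auto
    then show "finite ((\<lambda>w. length w mod i) ` lists A)" by (rule finite_subset) simp
  qed simp
  show ?thesis
  proof (rule enrichment_eq[OF assms, of MOD, OF MOD_def])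
    fix P assume "P \<in> {{w \<in> lists A. length w mod d = m} | m d. m < d}"
    then obtain m d where "m < d" "P = {w \<in> lists A. length w mod d = m}" by blast
    then show "\<exists>d\<in>{1..}. determines A (\<lambda>w. length w mod d) (\<lambda>w. w \<in> P)"
      by (intro bexI[of _ d]) (auto simp: determines_def)
  next
    fix i :: nat and u :: "'u list" assume "i \<in> {1..}"
    then have "length u mod i < i" by simp
    then show "{w \<in> lists A. length w mod i = length u mod i} \<in> MOD A"
      unfolding MOD_def by (blast intro: boolean_combinations.generator)
  qed
qed

section \<open>Renaming of letters in the enrichment by SU\<close>

lemma suff_enrichment_map_preimage:
  fixes C :: "'u::infinite lang_class"
  assumes C: "letter_closed C" and S: "finite S" and T: "finite T" and \<phi>: "\<phi> ` S \<subseteq> T"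
    and L: "L \<in> label_enrichment C (suff k) T"
  shows "{w \<in> lists S. map \<phi> w \<in> L} \<in> label_enrichment C (suff k) S"
proof -
  obtain LL where LL: "\<And>x. x \<in> suff k ` lists T \<Longrightarrow> LL x \<in> class_at C (suff k ` lists T \<times> T)"
    and L_eq: "L = {w \<in> lists T. enrich (suff k) w \<in> LL (suff k w)}"
    using L unfolding label_enrichment_def by blast
  \<comment> \<open>Suffixes commute with letter maps, so \<open>\<phi>\<close> acts on a decorated
    letter by acting on its label and on the letter itself.\<close>
  let ?\<psi> = "\<lambda>(x, a). (map \<phi> x, \<phi> a)"
  define MM where
    "MM x = {v \<in> lists (suff k ` lists S \<times> S). map ?\<psi> v \<in> LL (map \<phi> x)}" for x
  have map_lists: "map \<phi> w \<in> lists T" if "w \<in> lists S" for w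
    using that \<phi> by (auto simp: in_lists_conv_set)
  have map_suff: "map \<phi> x \<in> suff k ` lists T" if "x \<in> suff k ` lists S" for x
    using that map_lists by (fastforce simp: suff_map[symmetric] simp del: in_lists_conv_set)
  have "MM x \<in> class_at C (suff k ` lists S \<times> S)" if "x \<in> suff k ` lists S" for x
    unfolding MM_def
    by (rule class_at_map_preimage[OF C _ _ _ LL[OF map_suff[OF that]]])
       (use S T \<phi> map_suff in \<open>auto simp: finite_suff_image simp del: in_lists_conv_set\<close>)
  moreover have "enrich (suff k) (map \<phi> w) = map ?\<psi> (enrich (suff k) w)" for w
    by (simp add: enrich_def suff_map take_map)
  then have "{w \<in> lists S. map \<phi> w \<in> L} = {w \<in> lists S. enrich (suff k) w \<in> MM (suff k w)}"
    using map_lists enrich_in_lists_image[of _ S "suff k"]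
    by (simp add: L_eq MM_def suff_map del: in_lists_conv_set cong: conj_cong)
  ultimately show ?thesis unfolding label_enrichment_def by blast
qed

text \<open>Lets \<open>enrichment C SU\<close> take the place of the outer class in
  \<open>enrichment_MOD\<close>.\<close>

lemma letter_closed_enrichment_SU:
  fixes C :: "'u::infinite lang_class"
  assumes "letter_closed C"
  shows "letter_closed (enrichment C SU)"
  unfolding letter_closed_def
proof (intro allI impI ballI)
  fix A B L and \<phi> :: "'u \<Rightarrow> 'u"
  assume *: "finite A" "finite B" "\<phi> ` A \<subseteq> B" "L \<in> enrichment C SU B"
  then obtain k where "L \<in> label_enrichment C (suff k) B" using enrichment_SU[OF assms] by blast
  then have "{w \<in> lists A. map \<phi> w \<in> L} \<in> label_enrichment C (suff k) A"
    using suff_enrichment_map_preimage[OF assms *(1-3)] by blast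
  then show "{w \<in> lists A. map \<phi> w \<in> L} \<in> enrichment C SU A"
    using enrichment_SU[OF assms *(1)] by blast
qed

text \<open>Carries \<open>enrichment_SU\<close> to alphabets outside \<open>'u\<close>, such as
  blocks and pairs. Each direction is an inverse image under a renaming or under its
  inverse.\<close>

lemma class_at_enrichment_SU:
  fixes C :: "'u::infinite lang_class"
  assumes C: "letter_closed C" and S: "finite S"
  shows "class_at (enrichment C SU) S = (\<Union>k. label_enrichment C (suff k) S)"
proof (intro equalityI subsetI)
  fix K assume "K \<in> class_at (enrichment C SU) S"
  then obtain e where KS: "K \<subseteq> lists S" and e: "inj_on e S"
    and "map e ` K \<in> enrichment C SU (e ` S)"
    unfolding class_at_def by blast
  then obtain k where "map e ` K \<in> label_enrichment C (suff k) (e ` S)"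
    using enrichment_SU[OF C] S by blast
  then have "{w \<in> lists S. map e w \<in> map e ` K} \<in> label_enrichment C (suff k) S"
    by (intro suff_enrichment_map_preimage[OF C S finite_imageI[OF S]]) auto
  moreover have "{w \<in> lists S. map e w \<in> map e ` K} = K"
    using KS inj_on_map_lists[OF e] unfolding inj_on_def by blast
  ultimately show "K \<in> (\<Union>k. label_enrichment C (suff k) S)" by auto
next
  fix K assume "K \<in> (\<Union>k. label_enrichment C (suff k) S)"
  then obtain k where K: "K \<in> label_enrichment C (suff k) S" by blast
  then have KS: "K \<subseteq> lists S" unfolding label_enrichment_def by blast
  obtain e :: "_ \<Rightarrow> 'u" where e: "inj_on e S" using finite_inj_into_infinite[OF S] by blast
  have "{w \<in> lists (e ` S). map (inv_into S e) w \<in> K} \<in> label_enrichment C (suff k) (e ` S)"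
    by (rule suff_enrichment_map_preimage[OF C _ S _ K]) (use S e in auto)
  also have "{w \<in> lists (e ` S). map (inv_into S e) w \<in> K} = map e ` {w \<in> lists S. map (inv_into S e) (map e w) \<in> K}"
    unfolding lists_image by blast
  also have "{w \<in> lists S. map (inv_into S e) (map e w) \<in> K} = {w \<in> lists S. w \<in> K}"
    by (rule Collect_cong) (metis map_inv_into_map[OF e])
  also have "\<dots> = K" using KS by blast
  finally have "map e ` K \<in> enrichment C SU (e ` S)" using enrichment_SU[OF C] S by blast
  then show "K \<in> class_at (enrichment C SU) S" using KS e unfolding class_at_def by blast
qed


section \<open>Block words\<close>

lemma block_word_Nil [simp]: "block_word d [] = []"
  by (simp add: block_word_def)

text \<open>Replaces the index formula by a recursion on which the inductions below run. A word
  shorter than \<open>d\<close> fits, since \<open>take d w\<close> is then \<open>w\<close> and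
  \<open>drop d w\<close> is empty.\<close>

lemma block_word_rec:
  assumes d: "0 < d" and w: "w \<noteq> []"
  shows "block_word d w = take d w # block_word d (drop d w)"
proof (cases "length w < d")
  case True
  then show ?thesis using w by (simp add: block_word_def)
next
  case False
  then have len: "length w = d + length (drop d w)" by simp
  have q: "length w div d = Suc (length (drop d w) div d)"
    by (subst len) (use d in simp)
  have r: "length w mod d = length (drop d w) mod d"
    by (subst len) simp
  have "block_word d w = map (\<lambda>i. take d (drop (d * i) w)) [0..<Suc (length (drop d w) div d)] @
      (if length (drop d w) mod d = 0 then [] else [drop (d * Suc (length (drop d w) div d)) w])"
    unfolding block_word_def Let_def q r ..
  also have "\<dots> = take d w # block_word d (drop d w)"
    unfolding block_word_def Let_def upt_conv_Cons[OF zero_less_Suc] map_Suc_upt[symmetric]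
    by (simp add: ac_simps)
  finally show ?thesis .
qed

lemma block_word_append:
  assumes "0 < d" "d dvd length u"
  shows "block_word d (u @ v) = block_word d u @ block_word d v"
  using assms(2)
proof (induction "length u" arbitrary: u rule: less_induct)
  case less
  show ?case
  proof (cases "u = []")
    case False
    then have "d \<le> length u" using less.prems by (simp add: dvd_imp_le)
    moreover from this have "d dvd length (drop d u)" using less.prems by simp
    moreover have "length (drop d u) < length u" using False assms(1) by simp
    ultimately show ?thesis
      using less.hyps False by (simp add: block_word_rec[OF assms(1)])
  qed simp
qed

lemma block_word_short: "0 < d \<Longrightarrow> w \<noteq> [] \<Longrightarrow> length w \<le> d \<Longrightarrow> block_word d w = [w]"
  by (simp add: block_word_rec)

lemma block_word_cases:
  assumes "0 < d"
  obtains z s where "w = z @ s" "d dvd length z" "length s < d" "length w mod d = length s"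
proof
  let ?n = "length w div d * d"
  have "?n \<le> length w" by simp
  then show "d dvd length (take ?n w)" by (simp add: min_absorb2)
  show "length (drop ?n w) < d" using assms by (simp add: minus_div_mult_eq_mod)
qed (simp_all add: minus_div_mult_eq_mod)

lemma concat_block_word:
  assumes "0 < d"
  shows "concat (block_word d w) = w"
proof (induction "length w" arbitrary: w rule: less_induct)
  case less
  then show ?case using assms by (cases "w = []") (simp_all add: block_word_rec)
qed

lemma block_word_in_lists:
  assumes "0 < d" "w \<in> lists A"
  shows "block_word d w \<in> lists (block_alphabet d A)"
  using assms(2)
proof (induction "length w" arbitrary: w rule: less_induct)
  case less
  show ?case
  proof (cases "w = []")
    case False
    have "drop d w \<in> lists A" "take d w \<in> lists A"
      using less.prems by (auto dest: in_set_dropD in_set_takeD)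
    then show ?thesis
      using less.hyps[of "drop d w"] False assms(1)
      by (simp add: block_word_rec block_alphabet_def)
  qed simp
qed

lemma length_butlast_block_word:
  assumes "0 < d"
  shows "b \<in> set (butlast (block_word d w)) \<Longrightarrow> length b = d"
proof (induction "length w" arbitrary: w rule: less_induct)
  case less
  then have "w \<noteq> []" by auto
  moreover from this have "drop d w \<noteq> []"
    using less.prems assms by (auto simp: block_word_rec)
  ultimately have "b = take d w \<or> b \<in> set (butlast (block_word d (drop d w)))"
    using less.prems assms by (simp add: block_word_rec split: if_splits)
  then show ?case using less.hyps[of "drop d w"] \<open>w \<noteq> []\<close> \<open>drop d w \<noteq> []\<close> assms by auto
qed

lemma length_block_word:
  assumes "0 < d" "d * n \<le> length w"
  shows "n \<le> length (block_word d w)"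
proof -
  have "n \<le> length w div d" using assms by (metis div_le_mono nonzero_mult_div_cancel_left less_not_refl)
  then show ?thesis by (simp add: block_word_def Let_def)
qed

lemma finite_block_alphabet:
  assumes "finite A"
  shows "finite (block_alphabet d A)"
  by (rule finite_subset[OF _ finite_lists_length_le[OF assms, of d]])
     (auto simp: block_alphabet_def)

section \<open>Complete blocks and the remainder\<close>

definition full_blocks :: "nat \<Rightarrow> 'a list \<Rightarrow> 'a list list" where
  "full_blocks d w = block_word d (take (length w - length w mod d) w)"

lemma full_blocks_eq:
  assumes "d dvd length z" "length s < d"
  shows "full_blocks d (z @ s) = block_word d z"
proof -
  have "length (z @ s) mod d = length s" using assms by (auto simp: dvd_def)
  then show ?thesis by (simp add: full_blocks_def)
qed

text \<open>A letter completes a block exactly when the prefix before it has length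
  \<open>d - 1\<close> modulo \<open>d\<close>; the block then consists of the last
  \<open>d - 1\<close> letters of this prefix and the new letter. Thus complete blocks can be output
  while the word is read.\<close>

lemma full_blocks_snoc:
  assumes "0 < d"
  shows "full_blocks d (w @ [a]) =
    full_blocks d w @ (if length w mod d = d - 1 then [suff (d - 1) w @ [a]] else [])"
proof -
  obtain z s where w: "w = z @ s" "d dvd length z" "length s < d" "length w mod d = length s"
    using block_word_cases[OF assms] by blast
  show ?thesis
  proof (cases "length s = d - 1")
    case True
    \<comment> \<open>The letter \<open>a\<close> completes a block, so the new remainder is empty:
      \<open>full_blocks_eq\<close> is used with \<open>s = []\<close>, whence the trailing
      \<open>[]\<close>.\<close>
    have "full_blocks d ((z @ s @ [a]) @ []) = block_word d (z @ s @ [a])"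
      by (rule full_blocks_eq) (use True w assms in auto)
    also have "\<dots> = block_word d z @ [s @ [a]]"
      using True assms block_word_short[OF assms, of "s @ [a]"]
      by (simp add: block_word_append[OF assms w(2)])
    also have "block_word d z = full_blocks d w" using w(1) full_blocks_eq[OF w(2,3)] by simp
    finally show ?thesis using True w by (simp add: suff_append suff_id)
  next
    case False
    have "full_blocks d (z @ (s @ [a])) = block_word d z"
      by (rule full_blocks_eq) (use False w in auto)
    then show ?thesis using False w full_blocks_eq[OF w(2,3)] by simp
  qed
qed

text \<open>The residue is a separate argument because \<open>rest\<close> is also applied to a
  bounded suffix of the word read, whose own length does not show it.\<close>

definition rest :: "nat \<Rightarrow> 'a list \<Rightarrow> 'a list list" where
  "rest r w = (if suff r w = [] then [] else [suff r w])"

lemma block_word_full_blocks: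
  assumes "0 < d"
  shows "block_word d w = full_blocks d w @ rest (length w mod d) w"
proof -
  obtain z s where w: "w = z @ s" "d dvd length z" "length s < d" "length w mod d = length s"
    using block_word_cases[OF assms] by blast
  then have "suff (length w mod d) w = s" by (simp add: suff_append suff_id)
  then show ?thesis
    using w full_blocks_eq[OF w(2,3)] block_word_append[OF assms w(2)] block_word_short[OF assms, of s]
    by (auto simp: rest_def)
qed

text \<open>The last \<open>k\<close> complete blocks lie in the \<open>d * k\<close> letters before
  the remainder. Removing everything earlier cuts at a multiple of \<open>d\<close>, so the block
  boundaries in what is left do not move.\<close>

lemma suff_full_blocks:
  assumes "0 < d"
  shows "suff k (full_blocks d (suff (d * k + length w mod d) w)) = suff k (full_blocks d w)"
proof (cases "length w \<le> d * k + length w mod d")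
  case True
  then show ?thesis by (simp add: suff_id)
next
  case False
  obtain z s where w: "w = z @ s" "d dvd length z" "length s < d" "length w mod d = length s"
    using block_word_cases[OF assms] by blast
  have len: "d * k \<le> length z" using False w by simp
  define u v where "u = take (length z - d * k) z" and "v = suff (d * k) z"
  have z: "z = u @ v" and v: "length v = d * k"
    using len by (simp_all add: u_def v_def append_suff)
  have u: "d dvd length u" using w(2) len by (simp add: u_def)
  have "suff (d * k + length w mod d) w = v @ s"
    using len unfolding v_def w(4) by (simp add: w(1) suff_append suff_id)
  moreover have "full_blocks d (v @ s) = block_word d v"
    by (rule full_blocks_eq) (simp_all add: v w)
  moreover have "full_blocks d w = block_word d u @ block_word d v"
    using full_blocks_eq[OF w(2,3)] block_word_append[OF assms u] by (simp add: w(1) z)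
  moreover have "k \<le> length (block_word d v)" by (rule length_block_word[OF assms]) (simp add: v)
  ultimately show ?thesis by (simp add: suff_append)
qed

lemma full_blocks_in_lists:
  assumes "0 < d" "w \<in> lists A"
  shows "full_blocks d w \<in> lists (block_alphabet d A)"
  unfolding full_blocks_def
  by (rule block_word_in_lists[OF assms(1)]) (use assms(2) in \<open>auto dest: in_set_takeD\<close>)


section \<open>Enriching by lengths modulo d\<close>

abbreviation (input) len_mod :: "nat \<Rightarrow> 'a list \<Rightarrow> nat" where
  "len_mod d w \<equiv> length w mod d"

lemma enrich_len_mod_append:
  assumes "d dvd length u"
  shows "enrich (len_mod d) (u @ v) = enrich (len_mod d) u @ enrich (len_mod d) v"
  using assms by (auto simp: enrich_append dvd_def)

lemma dvd_length_concat: "\<forall>b \<in> set y. length b = d \<Longrightarrow> d dvd length (concat y)"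
  by (induction y) auto

lemma length_le_concat: "[] \<notin> set y \<Longrightarrow> length y \<le> length (concat y)"
proof (induction y)
  case (Cons b y)
  then have "0 < length b" by (metis length_greater_0_conv list.set_intros(1))
  moreover have "length y \<le> length (concat y)" using Cons by simp
  ultimately show ?case unfolding concat.simps length_append length_Cons by linarith
qed simp

text \<open>The omitted part \<open>z\<close> consists of complete blocks, so dropping it shifts no
  residue. If it is nonempty, the kept blocks have at least \<open>k\<close> letters in total
  because blocks are nonempty.\<close>

lemma suff_blocks_split:
  assumes "[] \<notin> set y" "\<forall>b \<in> set (butlast y). length b = d"
  obtains z where "concat y = z @ concat (suff (Suc k) y)" "d dvd length z"
    "z = [] \<or> k \<le> length (concat (suff (Suc k) y))"
proof
  let ?z = "take (length y - Suc k) y" and ?s = "suff (Suc k) y"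
  show "concat y = concat ?z @ concat ?s"
    by (metis append_suff concat_append)
  \<comment> \<open>At least one block is kept, so the last block, the only one that may be short,
    is not among the omitted ones.\<close>
  have "set ?z \<subseteq> set (butlast y)"
  proof (cases "y = []")
    case False
    have "?z = take (length y - Suc k) (butlast y)"
      using False by (simp add: butlast_conv_take min_def)
    then show ?thesis by (metis set_take_subset)
  qed simp
  then show "d dvd length (concat ?z)" using assms(2) by (intro dvd_length_concat) blast
  have "[] \<notin> set ?s" using assms(1) by (auto simp: suff_def dest: in_set_dropD)
  then have "length ?s \<le> length (concat ?s)" by (rule length_le_concat)
  then show "concat ?z = [] \<or> k \<le> length (concat ?s)"
    by (cases "length y \<le> Suc k") auto
qed

text \<open>At a block \<open>b\<close>, the label \<open>x\<close> holds up to \<open>k + 1\<close>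
  previous blocks, all of length \<open>d\<close>. Hence \<open>b\<close> starts at residue
  \<open>0\<close>, and the last \<open>k\<close> decorated letters before \<open>b\<close> can be
  found in \<open>x\<close>. So \<alpha> can decorate the letters of \<open>b\<close> twice, with
  residues and then with suffixes.\<close>

lemma enrich_blocks:
  fixes k d :: nat
  defines "\<alpha> \<equiv> \<lambda>(x, b). enrich (\<lambda>t. suff k (enrich (len_mod d) (concat x) @ t)) (enrich (len_mod d) b)"
  assumes "[] \<notin> set y" "\<forall>b \<in> set (butlast y). length b = d"
  shows "concat (map \<alpha> (enrich (suff (Suc k)) y)) = enrich (suff k) (enrich (len_mod d) (concat y))"
  using assms(2,3)
proof (induction y rule: rev_induct)
  case (snoc b y)
  then have y: "[] \<notin> set y" and all: "\<forall>c \<in> set y. length c = d" by auto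
  then have bl: "\<forall>c \<in> set (butlast y). length c = d" by (auto dest: in_set_butlastD)
  obtain z where z: "concat y = z @ concat (suff (Suc k) y)" "d dvd length z"
    "z = [] \<or> k \<le> length (concat (suff (Suc k) y))"
    using suff_blocks_split[OF y bl] by blast
  \<comment> \<open>Omitting \<open>z\<close> keeps the last \<open>k\<close> decorated letters:
    either \<open>z\<close> is empty or the kept blocks have enough letters.\<close>
  have ctx: "suff k (enrich (len_mod d) (concat (suff (Suc k) y)) @ t)
      = suff k (enrich (len_mod d) (concat y) @ t)" for t
  proof (cases "z = []")
    case True
    then show ?thesis using z(1) by simp
  next
    case False
    then show ?thesis
      using z(3) unfolding z(1) enrich_len_mod_append[OF z(2)] by (simp add: suff_append)
  qed
  have "enrich (suff k) (enrich (len_mod d) (concat (y @ [b])))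
      = enrich (suff k) (enrich (len_mod d) (concat y))
        @ enrich (\<lambda>t. suff k (enrich (len_mod d) (concat y) @ t)) (enrich (len_mod d) b)"
    using enrich_len_mod_append[OF dvd_length_concat[OF all]] by (simp add: enrich_append)
  then show ?case
    using snoc.IH[OF y bl] by (simp add: enrich_snoc \<alpha>_def ctx)
qed simp

text \<open>The morphism \<alpha> erases all letters except those at residue \<open>d - 1\<close>,
  each of which outputs the block it completes, labelled with the last \<open>k\<close> complete
  blocks before it. This looks at \<open>d * k + (d - 1)\<close> earlier letters, within the bound
  \<open>d * k + d\<close>. The label \<open>x\<close> is a word of decorated letters, hence
  \<open>map snd\<close>.\<close>

lemma enrich_full_blocks:
  fixes k d :: nat
  defines "\<alpha> \<equiv> \<lambda>(x, p, a).
    if p = d - 1 then [(suff k (full_blocks d (suff (d * k + p) (map snd x))), suff (d - 1) (map snd x) @ [a])]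
    else []"
  assumes d: "0 < d"
  shows "concat (map \<alpha> (enrich (suff (d * k + d)) (enrich (len_mod d) w))) = enrich (suff k) (full_blocks d w)"
proof (induction w rule: rev_induct)
  case Nil then show ?case by (simp add: full_blocks_def)
next
  case (snoc a w)
  have ctx: "suff j (map snd (suff (d * k + d) (enrich (len_mod d) w))) = suff j w"
    if "j \<le> d * k + d" for j
    using that by (simp add: suff_map[symmetric] suff_suff)
  show ?case
  proof (cases "length w mod d = d - 1")
    case True
    have "concat (map \<alpha> (enrich (suff (d * k + d)) (enrich (len_mod d) (w @ [a]))))
        = enrich (suff k) (full_blocks d w)
          @ [(suff k (full_blocks d (suff (d * k + length w mod d) w)), suff (d - 1) w @ [a])]"
      using snoc.IH True by (simp add: enrich_snoc \<alpha>_def ctx)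
    then show ?thesis
      using True suff_full_blocks[OF d, of k w] by (simp add: full_blocks_snoc[OF d] enrich_snoc)
  next
    case False
    then show ?thesis using snoc.IH by (simp add: enrich_snoc \<alpha>_def full_blocks_snoc[OF d])
  qed
qed

lemma finite_len_mod: "0 < d \<Longrightarrow> finite (len_mod d ` X)"
  by (rule finite_subset[of _ "{..<d}"]) auto

section \<open>From lengths modulo d to blocks\<close>

lemma enrichment_MOD_subset_block_abstraction:
  fixes C :: "'u::infinite lang_class"
  assumes C: "positive_variety C" and A: "finite A"
  shows "enrichment (enrichment C SU) MOD A \<subseteq> block_abstraction (enrichment C SU) A"
proof
  note lc = positive_variety_letter_closed[OF C]
  fix L assume "L \<in> enrichment (enrichment C SU) MOD A"
  then obtain d where "d \<in> {1..}" and L: "L \<in> label_enrichment (enrichment C SU) (len_mod d) A"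
    unfolding enrichment_MOD[OF letter_closed_enrichment_SU[OF lc] A] by (rule UN_E)
  then have d: "0 < d" by simp
  define R where "R = len_mod d ` lists A"
  have finR: "finite R" unfolding R_def using d by (rule finite_len_mod)
  then have finRA: "finite (R \<times> A)" using A by simp
  obtain LL where LL: "\<And>r. r \<in> R \<Longrightarrow> LL r \<in> class_at (enrichment C SU) (R \<times> A)"
    and L_eq: "L = {w \<in> lists A. enrich (len_mod d) w \<in> LL (len_mod d w)}"
    using label_enrichmentE[OF L] unfolding R_def by blast
  have "\<forall>r \<in> R. \<exists>k. LL r \<in> label_enrichment C (suff k) (R \<times> A)"
    using LL unfolding class_at_enrichment_SU[OF lc finRA] by blast
  then obtain kk where kk: "\<forall>r \<in> R. LL r \<in> label_enrichment C (suff (kk r)) (R \<times> A)" by metis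
  \<comment> \<open>There are finitely many residues, so one suffix length serves all the languages
    \<open>LL r\<close>.\<close>
  obtain k where k: "\<forall>r \<in> R. kk r \<le> k"
    using finite_imageI[OF finR, of kk] by (metis finite_nat_set_iff_bounded_le imageI)
  define T where "T = suff k ` lists (R \<times> A) \<times> (R \<times> A)"
  have LLk: "LL r \<in> label_enrichment C (suff k) (R \<times> A)" if "r \<in> R" for r
    using that kk k label_enrichment_determines[OF lc finRA finite_suff_image[OF finRA] suff_determines] by blast
  have "\<forall>r \<in> R. \<exists>KK. (\<forall>x \<in> suff k ` lists (R \<times> A). KK x \<in> class_at C T) \<and>
      LL r = {v \<in> lists (R \<times> A). enrich (suff k) v \<in> KK (suff k v)}"
  proof
    fix r assume "r \<in> R"
    obtain KK where "\<And>x. x \<in> suff k ` lists (R \<times> A) \<Longrightarrow> KK x \<in> class_at C T"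
      "LL r = {v \<in> lists (R \<times> A). enrich (suff k) v \<in> KK (suff k v)}"
      using label_enrichmentE[OF LLk[OF \<open>r \<in> R\<close>]] unfolding T_def by blast
    then show "\<exists>KK. (\<forall>x \<in> suff k ` lists (R \<times> A). KK x \<in> class_at C T) \<and>
        LL r = {v \<in> lists (R \<times> A). enrich (suff k) v \<in> KK (suff k v)}"
      by (intro exI[of _ KK] conjI ballI)
  qed
  then have "\<exists>KK. \<forall>r \<in> R. (\<forall>x \<in> suff k ` lists (R \<times> A). KK r x \<in> class_at C T) \<and>
      LL r = {v \<in> lists (R \<times> A). enrich (suff k) v \<in> KK r (suff k v)}"
    by (rule bchoice)
  then obtain KK where
    *: "\<forall>r \<in> R. (\<forall>x \<in> suff k ` lists (R \<times> A). KK r x \<in> class_at C T) \<and>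
      LL r = {v \<in> lists (R \<times> A). enrich (suff k) v \<in> KK r (suff k v)}"
    by (rule exE)
  have KK: "KK r x \<in> class_at C T" if "r \<in> R" "x \<in> suff k ` lists (R \<times> A)" for r x
    using * that by blast
  have LL_eq: "LL r = {v \<in> lists (R \<times> A). enrich (suff k) v \<in> KK r (suff k v)}" if "r \<in> R" for r
    using * that by blast
  define B where "B = block_alphabet d A"
  have finB: "finite B" unfolding B_def by (rule finite_block_alphabet[OF A])
  have concat_B: "concat y \<in> lists A" if "y \<in> lists B" for y
    using that by (auto simp: B_def block_alphabet_def in_lists_conv_set)
  have len_mod_R: "enrich (len_mod d) u \<in> lists (R \<times> A)" if "u \<in> lists A" for u
    unfolding R_def by (rule enrich_in_lists_image[OF that])
  \<comment> \<open>The morphism of \<open>enrich_blocks\<close>: a block becomes the word of its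
    letters, decorated twice.\<close>
  define \<alpha> where "\<alpha> = (\<lambda>(x, b :: 'u list).
    enrich (\<lambda>t. suff k (enrich (len_mod d) (concat x) @ t)) (enrich (len_mod d) b))"
  \<comment> \<open>The label \<open>suff (Suc k)\<close> contains the last block also if \<open>k = 0\<close>; that block alone may be shorter
    than \<open>d\<close>, so the length modulo \<open>d\<close> can be read off.\<close>
  define K where "K = {y \<in> lists B. concat (map \<alpha> (enrich (suff (Suc k)) y)) @ [] \<in>
     KK (len_mod d (concat (suff (Suc k) y))) (suff k (enrich (len_mod d) (concat (suff (Suc k) y))))}"
  have "K \<in> label_enrichment C (suff (Suc k)) B"
    unfolding K_def
  \<comment> \<open>The appended word \<open>c\<close> is constantly empty here, which is why
    \<open>K\<close> is written with \<open>@ []\<close>.\<close>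
  proof (rule label_enrichmentI[OF C finB finite_suff_image[OF finB], where T = T])
    show "finite T" unfolding T_def using finRA finite_suff_image[OF finRA] by simp
  next
    fix x b assume "x \<in> suff (Suc k) ` lists B" and b: "b \<in> B"
    from this(1) have x: "x \<in> lists B" by (rule subsetD[OF suff_image_lists])
    have "b \<in> lists A" using b by (simp add: B_def block_alphabet_def)
    then show "\<alpha> (x, b) \<in> lists T"
      unfolding T_def \<alpha>_def prod.case
      by (intro enrich_in_lists[OF len_mod_R] imageI)
         (simp_all only: append_in_lists_conv len_mod_R[OF concat_B[OF x]] simp_thms)
  next
    fix x assume "x \<in> suff (Suc k) ` lists B"
    then have x: "concat x \<in> lists A" by (intro concat_B subsetD[OF suff_image_lists])
    show "KK (len_mod d (concat x)) (suff k (enrich (len_mod d) (concat x))) \<in> class_at C T"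
      by (rule KK) (use x len_mod_R[OF x] in \<open>auto simp: R_def simp del: in_lists_conv_set\<close>)
  qed
  then have K: "K \<in> class_at (enrichment C SU) B" unfolding class_at_enrichment_SU[OF lc finB] by blast
  have "w \<in> L \<longleftrightarrow> block_word d w \<in> K" if w: "w \<in> lists A" for w
  proof -
    define y where "y = block_word d w"
    have y: "y \<in> lists B" unfolding y_def B_def by (rule block_word_in_lists[OF d w])
    have cy: "concat y = w" unfolding y_def by (rule concat_block_word[OF d])
    have y1: "[] \<notin> set y" using y by (auto simp: B_def block_alphabet_def)
    have y2: "\<forall>b \<in> set (butlast y). length b = d"
      using length_butlast_block_word[OF d] by (auto simp: y_def)
    obtain z where z: "concat y = z @ concat (suff (Suc k) y)" "d dvd length z"
      "z = [] \<or> k \<le> length (concat (suff (Suc k) y))"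
      using suff_blocks_split[OF y1 y2] by blast
    \<comment> \<open>The omitted blocks have total length divisible by \<open>d\<close>, so the
      last \<open>k + 1\<close> blocks show the residue of the whole length.\<close>
    have 1: "len_mod d (concat (suff (Suc k) y)) = len_mod d w"
      using z(1,2) cy by (auto simp: dvd_def)
    have 2: "suff k (enrich (len_mod d) (concat (suff (Suc k) y))) = suff k (enrich (len_mod d) w)"
    proof (cases "z = []")
      case True
      then show ?thesis using z(1) cy by simp
    next
      case False
      have "enrich (len_mod d) w = enrich (len_mod d) z @ enrich (len_mod d) (concat (suff (Suc k) y))"
        using enrich_len_mod_append[OF z(2)] z(1) cy by metis
      then show ?thesis using False z(3) by (simp add: suff_append)
    qed
    have "concat (map \<alpha> (enrich (suff (Suc k)) y)) = enrich (suff k) (enrich (len_mod d) w)"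
      using enrich_blocks[OF y1 y2, of k] unfolding \<alpha>_def cy .
    then have "y \<in> K \<longleftrightarrow> enrich (suff k) (enrich (len_mod d) w) \<in> KK (len_mod d w) (suff k (enrich (len_mod d) w))"
      using y by (simp add: K_def 1 2 del: in_lists_conv_set)
    moreover have "len_mod d w \<in> R" unfolding R_def using w by blast
    ultimately show ?thesis
      using w len_mod_R[OF w] by (simp add: L_eq LL_eq y_def del: in_lists_conv_set)
  qed
  then have L_K: "L = {w \<in> lists A. block_word d w \<in> K}" unfolding L_eq by blast
  show "L \<in> block_abstraction (enrichment C SU) A"
    unfolding block_abstraction_def
  proof (rule UN_I)
    show "L \<in> block_abstraction_at d (enrichment C SU) A"
      using K L_K unfolding block_abstraction_at_def B_def by blast
  qed (use d in simp)
qed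

section \<open>From blocks to lengths modulo d\<close>

lemma block_abstraction_subset_enrichment_MOD:
  fixes C :: "'u::infinite lang_class"
  assumes C: "positive_variety C" and A: "finite A"
  shows "block_abstraction (enrichment C SU) A \<subseteq> enrichment (enrichment C SU) MOD A"
proof
  note lc = positive_variety_letter_closed[OF C]
  fix L assume "L \<in> block_abstraction (enrichment C SU) A"
  then obtain d where "d \<in> {1..}" and "L \<in> block_abstraction_at d (enrichment C SU) A"
    unfolding block_abstraction_def by (rule UN_E)
  then obtain K where d: "0 < d" and K: "K \<in> class_at (enrichment C SU) (block_alphabet d A)"
    and L_eq: "L = {w \<in> lists A. block_word d w \<in> K}"
    unfolding block_abstraction_at_def by auto
  define B where "B = block_alphabet d A"
  have finB: "finite B" unfolding B_def by (rule finite_block_alphabet[OF A])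
  obtain k where Kk: "K \<in> label_enrichment C (suff k) B"
    using K unfolding B_def[symmetric] class_at_enrichment_SU[OF lc finB] by blast
  obtain KK where
    KK: "\<And>x. x \<in> suff k ` lists B \<Longrightarrow> KK x \<in> class_at C (suff k ` lists B \<times> B)"
    and K_eq: "K = {y \<in> lists B. enrich (suff k) y \<in> KK (suff k y)}"
    using label_enrichmentE[OF Kk] by blast
  define T where "T = suff k ` lists B \<times> B"
  define R where "R = len_mod d ` lists A"
  have finRA: "finite (R \<times> A)" unfolding R_def by (rule finite_cartesian_product[OF finite_len_mod[OF d] A])
  \<comment> \<open>Long enough for the last \<open>k\<close> complete blocks together with a
    remainder of at most \<open>d - 1\<close> letters.\<close>
  define N where "N = d * k + d"
  define ctx where "ctx p u = full_blocks d (suff (d * k + p) u)" for p and u :: "'u list"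
  define \<alpha> where "\<alpha> = (\<lambda>(x :: (nat \<times> 'u) list, p, a).
    if p = d - 1 then [(suff k (ctx p (map snd x)), suff (d - 1) (map snd x) @ [a])] else [])"
  \<comment> \<open>The decorated incomplete last block: \<open>rest\<close> is empty or a single
    letter, and its label is formed by the last \<open>k\<close> complete blocks.\<close>
  define tail where "tail r x = map (Pair (suff k (ctx r (map snd x)))) (rest r (map snd x))"
    for r and x :: "(nat \<times> 'u) list"
  \<comment> \<open>The label of the entire block word, recovered from a bounded suffix; it selects
    the language \<open>KK\<close>.\<close>
  define final where "final r x = suff k (ctx r (map snd x) @ rest r (map snd x))"
    for r and x :: "(nat \<times> 'u) list"
  have ctx_B: "ctx p u \<in> lists B" if "u \<in> lists A" for p u
    unfolding ctx_def B_def by (intro full_blocks_in_lists[OF d] suff_in_lists that)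
  have rest_B: "rest r u \<in> lists B" if "u \<in> lists A" "r \<in> R" for r u
    using suff_in_lists[OF that(1), of r] that(2) d
    by (auto simp: rest_def B_def block_alphabet_def R_def min.coboundedI2)
  \<comment> \<open>With \<open>r\<close> fixed by the label of MOD, the word to append and the
    language to test depend only on the last \<open>N\<close> decorated letters, as
    \<open>label_enrichmentI\<close> requires.\<close>
  define LL where "LL r = {v \<in> lists (R \<times> A).
      concat (map \<alpha> (enrich (suff N) v)) @ tail r (suff N v) \<in> KK (final r (suff N v))}" for r
  have snd_lists: "map snd x \<in> lists A" if "x \<in> suff N ` lists (R \<times> A)" for x
    using subsetD[OF suff_image_lists that] by (auto simp: in_lists_conv_set)
  have "LL r \<in> class_at (enrichment C SU) (R \<times> A)" if r: "r \<in> R" for r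
  proof -
    have "LL r \<in> label_enrichment C (suff N) (R \<times> A)"
      unfolding LL_def
    proof (rule label_enrichmentI[OF C finRA finite_suff_image[OF finRA], where T = T])
      show "finite T" unfolding T_def using finB finite_suff_image[OF finB] by simp
    next
      fix x pa assume x: "x \<in> suff N ` lists (R \<times> A)" and "pa \<in> R \<times> A"
      then obtain p a where pa: "pa = (p, a)" "a \<in> A" by blast
      have "suff (d - 1) (map snd x) @ [a] \<in> B"
        using suff_in_lists[OF snd_lists[OF x], of "d - 1"] pa(2) d
        by (auto simp: B_def block_alphabet_def)
      then show "\<alpha> (x, pa) \<in> lists T"
        using ctx_B[OF snd_lists[OF x]] by (simp add: \<alpha>_def pa T_def)
    next
      fix x assume x: "x \<in> suff N ` lists (R \<times> A)"
      have "ctx r (map snd x) @ rest r (map snd x) \<in> lists B"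
        using ctx_B[OF snd_lists[OF x]] rest_B[OF snd_lists[OF x] r]
        by (simp only: append_in_lists_conv)
      then show "KK (final r x) \<in> class_at C T"
        unfolding T_def final_def by (intro KK imageI)
    qed
    then show ?thesis unfolding class_at_enrichment_SU[OF lc finRA] by blast
  qed
  moreover have "L = {w \<in> lists A. enrich (len_mod d) w \<in> LL (len_mod d w)}"
    unfolding L_eq
  proof (intro Collect_cong conj_cong refl)
    fix w assume w: "w \<in> lists A"
    define r where "r = len_mod d w"
    have r: "r < d" using d by (simp add: r_def)
    define x where "x = suff N (enrich (len_mod d) w)"
    have snd_x: "map snd x = suff N w" by (simp add: x_def suff_map[symmetric])
    have ctx: "suff k (ctx r (map snd x)) = suff k (full_blocks d w)"
      using suff_full_blocks[OF d, of k w] r by (simp add: ctx_def snd_x suff_suff N_def r_def)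
    have rest: "rest r (map snd x) = rest r w"
      using r by (simp add: rest_def snd_x suff_suff N_def)
    have bw: "block_word d w = full_blocks d w @ rest r w"
      unfolding r_def by (rule block_word_full_blocks[OF d])
    \<comment> \<open>\<open>ctx\<close> is known to agree with the complete blocks of
      \<open>w\<close> in the last \<open>k\<close> entries, which is all that a suffix of length
      \<open>k\<close> sees after \<open>rest\<close> is appended.\<close>
    have fin: "final r x = suff k (block_word d w)"
      unfolding final_def bw rest by (metis ctx suff_suff_append)
    have "concat (map \<alpha> (enrich (suff N) (enrich (len_mod d) w))) = enrich (suff k) (full_blocks d w)"
      using enrich_full_blocks[OF d, of k w] unfolding \<alpha>_def N_def ctx_def .
    \<comment> \<open>\<open>rest\<close> has at most one letter, so \<open>enrich_snoc\<close> adds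
      exactly the decorated letter in \<open>tail\<close>.\<close>
    then have run: "concat (map \<alpha> (enrich (suff N) (enrich (len_mod d) w))) @ tail r x = enrich (suff k) (block_word d w)"
      unfolding tail_def ctx rest bw by (simp add: rest_def enrich_snoc)
    have "enrich (len_mod d) w \<in> lists (R \<times> A)" unfolding R_def by (rule enrich_in_lists_image[OF w])
    moreover have "block_word d w \<in> lists B" unfolding B_def by (rule block_word_in_lists[OF d w])
    ultimately show "block_word d w \<in> K \<longleftrightarrow> enrich (len_mod d) w \<in> LL (len_mod d w)"
      using run fin unfolding LL_def K_eq r_def[symmetric] x_def by simp
  qed
  ultimately have "L \<in> label_enrichment (enrichment C SU) (len_mod d) A"
    unfolding label_enrichment_def R_def by blast
  then show "L \<in> enrichment (enrichment C SU) MOD A"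
    unfolding enrichment_MOD[OF letter_closed_enrichment_SU[OF lc] A]
    by (rule UN_I[rotated]) (use d in simp)
qed

theorem theorem6p6:
  fixes C :: "'u::infinite lang_class"
  assumes "positive_variety C"
  shows "\<forall>A. finite A \<longrightarrow>
           enrichment (enrichment C SU) MOD A = block_abstraction (enrichment C SU) A"
  using enrichment_MOD_subset_block_abstraction[OF assms]
    block_abstraction_subset_enrichment_MOD[OF assms] by (simp add: subset_antisym)

end
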